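(* Let $\mathfrak{A}$ be a residuated lattice. The following assertions are equivalent: (1) $\mathfrak{A}$ is Gelfand; (2) the map $\rho_{m}:Max_{h}(\mathfrak{A})\longrightarrow Spp(\mathfrak{A})$, given by $\mathfrak{m}\mapsto \rho(\mathfrak{m})$, is a homeomorphism.
   Context: A residuated lattice is an algebra $\mathfrak{A}=(A;\vee,\wedge,\odot,\rightarrow,0,1)$ such that $(A;\vee,\wedge,0,1)$ is a bounded lattice, $(A;\odot,1)$ is a commutative monoid, and $x\odot y\le z$ iff $x\le y\rightarrow z$ for all $x,y,z\in A$. A filter of $\mathfrak{A}$ is a non-empty subset $F\subseteq A$ such that $x,y\in F$ implies $x\odot y\in F$, and $x\in F$, $y\in A$ imply $x\vee y\in F$. For a family $\mathcal{F}$ of filters, $\veebar\mathcal{F}$ is the filter generated by $\bigcup\mathcal{F}$ (binary version: $F\veebar G$). A filter is proper if it is not $A$; a maximal filter is a maximal element (under inclusion) among proper filters; a prime filter is a proper filter $\mathfrak{p}$ such that $x\vee y\in\mathfrak{p}$ implies $x\in\mathfrak{p}$ or $y\in\mathfrak{p}$. $Spec(\mathfrak{A})$ and $Max(\mathfrak{A})$ are the sets of prime and maximal filters; $Max(\mathfrak{A})\subseteq Spec(\mathfrak{A})$. $\mathfrak{A}$ is Gelfand if every prime filter is contained in a unique maximal filter. $Max_h(\mathfrak{A})$ is $Max(\mathfrak{A})$ with the hull-kernel topology, whose closed basis consists of the sets $\{\mathfrak{m}\in Max(\mathfrak{A})\mid x\in\mathfrak{m}\}$, $x\in A$. For a filter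 $F$, $\sigma(F)$ is the intersection of all prime filters $\mathfrak{q}$ such that $\mathfrak{q}\subseteq\mathfrak{p}$ for some prime filter $\mathfrak{p}\supseteq F$ (an empty intersection is $A$); equivalently $\sigma(F)=\{a\in A\mid F\veebar a^{\perp}=A\}$, where $a^{\perp}=\{x\in A\mid x\vee a=1\}$. $\sigma(F)$ is a filter contained in $F$. $F$ is pure if $\sigma(F)=F$; $\sigma(\mathfrak{A})$ is the set of pure filters. The join $\veebar$ of any family of pure filters is pure, and the pure part of a filter $F$ is $\rho(F)=\veebar\{G\in\sigma(\mathfrak{A})\mid G\subseteq F\}$, the largest pure filter contained in $F$. A proper pure filter $P$ is purely-prime if $F_1\cap F_2\subseteq P$ implies $F_1\subseteq P$ or $F_2\subseteq P$ for all $F_1,F_2\in\sigma(\mathfrak{A})$. The pure spectrum $Spp(\mathfrak{A})$ is the set of purely-prime filters with the topology whose open sets are $d_p(F)=\{P\in Spp(\mathfrak{A})\mid F\nsubseteq P\}$, $F\in\sigma(\mathfrak{A})$. For every prime filter $\mathfrak{p}$, $\rho(\mathfrak{p})\in Spp(\mathfrak{A})$, so $\rho_m$ is well defined. *)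

theory Defs
  imports "HOL-Analysis.Abstract_Topology"
begin

text \<open>The universe of the algebra is the whole type, so a filter is proper iff it differs from
  \<^term>\<open>UNIV\<close>. The constants $0$ and $1$ are \<^const>\<open>bot\<close> and \<^const>\<open>top\<close>; the one-element
  algebra is allowed.\<close>

class residuated_lattice = bounded_lattice +
  fixes rl_mult :: "'a \<Rightarrow> 'a \<Rightarrow> 'a"  (infixl \<open>\<odot>\<close> 70)
    and rl_imp :: "'a \<Rightarrow> 'a \<Rightarrow> 'a"  (infixr \<open>\<^bold>\<rightarrow>\<close> 60)
  assumes rl_mult_assoc: "(x \<odot> y) \<odot> z = x \<odot> (y \<odot> z)"
    and rl_mult_commute: "x \<odot> y = y \<odot> x"
    and rl_mult_top: "x \<odot> top = x"
    and rl_residuation: "x \<odot> y \<le> z \<longleftrightarrow> x \<le> y \<^bold>\<rightarrow> z"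

definition rl_filter :: "'a::residuated_lattice set \<Rightarrow> bool" where
  "rl_filter F \<longleftrightarrow> F \<noteq> {} \<and> (\<forall>x\<in>F. \<forall>y\<in>F. x \<odot> y \<in> F) \<and> (\<forall>x\<in>F. \<forall>y. sup x y \<in> F)"

definition filter_join :: "'a::residuated_lattice set set \<Rightarrow> 'a set" where
  "filter_join \<F> = \<Inter>{G. rl_filter G \<and> \<Union>\<F> \<subseteq> G}"

definition proper_filter :: "'a::residuated_lattice set \<Rightarrow> bool" where
  "proper_filter F \<longleftrightarrow> rl_filter F \<and> F \<noteq> UNIV"

definition maximal_filter :: "'a::residuated_lattice set \<Rightarrow> bool" where
  "maximal_filter M \<longleftrightarrow> proper_filter M \<and> (\<forall>F. proper_filter F \<longrightarrow> M \<subseteq> F \<longrightarrow> F = M)"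

definition prime_filter :: "'a::residuated_lattice set \<Rightarrow> bool" where
  "prime_filter P \<longleftrightarrow> proper_filter P \<and> (\<forall>x y. sup x y \<in> P \<longrightarrow> x \<in> P \<or> y \<in> P)"

definition Max_filters :: "'a::residuated_lattice set set" where
  "Max_filters = {M. maximal_filter M}"

definition gelfand :: "'a::residuated_lattice itself \<Rightarrow> bool" where
  "gelfand _ \<longleftrightarrow> (\<forall>P::'a set. prime_filter P \<longrightarrow> (\<exists>!M. maximal_filter M \<and> P \<subseteq> M))"

text \<open>The sets \<open>{M \<in> Max_filters. x \<in> M}\<close> form a basis of closed sets, so the open sets are
  the unions of their complements.\<close>

definition Max_h :: "'a::residuated_lattice set topology" where
  "Max_h = topology (\<lambda>U. \<exists>X. U = (\<Union>x\<in>X. Max_filters - {M \<in> Max_filters. x \<in> M}))"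

definition sigma :: "'a::residuated_lattice set \<Rightarrow> 'a set" where
  "sigma F = \<Inter>{Q. prime_filter Q \<and> (\<exists>P. prime_filter P \<and> F \<subseteq> P \<and> Q \<subseteq> P)}"

definition pure_filter :: "'a::residuated_lattice set \<Rightarrow> bool" where
  "pure_filter F \<longleftrightarrow> rl_filter F \<and> sigma F = F"

definition pure_part :: "'a::residuated_lattice set \<Rightarrow> 'a set" where
  "pure_part F = filter_join {G. pure_filter G \<and> G \<subseteq> F}"

definition purely_prime :: "'a::residuated_lattice set \<Rightarrow> bool" where
  "purely_prime P \<longleftrightarrow> pure_filter P \<and> P \<noteq> UNIV \<and>
     (\<forall>F G. pure_filter F \<longrightarrow> pure_filter G \<longrightarrow> F \<inter> G \<subseteq> P \<longrightarrow> F \<subseteq> P \<or> G \<subseteq> P)"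

definition Spp_filters :: "'a::residuated_lattice set set" where
  "Spp_filters = {P. purely_prime P}"

definition d_p :: "'a::residuated_lattice set \<Rightarrow> 'a set set" where
  "d_p F = {P \<in> Spp_filters. \<not> F \<subseteq> P}"

definition Spp :: "'a::residuated_lattice set topology" where
  "Spp = topology (\<lambda>U. \<exists>F. pure_filter F \<and> U = d_p F)"

text \<open>The remaining lemmas show that the two families of sets passed to \<^const>\<open>topology\<close> are
  topologies, so that \<open>Max_h\<close> and \<open>Spp\<close> have the intended open sets.\<close>

lemma rl_mult_mono:
  fixes a b c d :: "'a::residuated_lattice"
  assumes "a \<le> b" "c \<le> d" shows "a \<odot> c \<le> b \<odot> d"
proof -
  have 1: "x \<odot> z \<le> y \<odot> z" if "x \<le> y" for x y z :: 'a
    using that by (meson order_refl order_trans rl_residuation)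
  show ?thesis using 1[OF assms(1), of c] 1[OF assms(2), of b]
    by (metis order_trans rl_mult_commute)
qed

lemma rl_mult_le: fixes a b :: "'a::residuated_lattice" shows "a \<odot> b \<le> a" "a \<odot> b \<le> b"
  by (metis order_refl rl_mult_mono rl_mult_top top_greatest,
      metis order_refl rl_mult_commute rl_mult_mono rl_mult_top top_greatest)

lemma rl_mult_sup: fixes a b c :: "'a::residuated_lattice"
  shows "a \<odot> sup b c \<le> sup (a \<odot> b) (a \<odot> c)"
proof -
  have "b \<odot> a \<le> sup (a \<odot> b) (a \<odot> c)" "c \<odot> a \<le> sup (a \<odot> b) (a \<odot> c)"
    by (simp_all add: rl_mult_commute)
  then have "sup b c \<odot> a \<le> sup (a \<odot> b) (a \<odot> c)"
    by (simp add: rl_residuation)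
  then show ?thesis by (simp add: rl_mult_commute)
qed

lemma rl_sup_mult: fixes a b c :: "'a::residuated_lattice"
  shows "sup a b \<odot> sup a c \<le> sup a (b \<odot> c)"
proof -
  have "sup a b \<odot> sup a c \<le> sup (sup a b \<odot> a) (sup a b \<odot> c)"
    by (rule rl_mult_sup)
  moreover have "sup a b \<odot> a \<le> a" by (rule rl_mult_le)
  moreover have "sup a b \<odot> c \<le> sup a (b \<odot> c)"
    by (metis order_trans rl_mult_commute rl_mult_le(2) rl_mult_sup sup.mono order_refl)
  ultimately show ?thesis by (meson le_sup_iff order_trans sup_ge1)
qed

lemma rl_filter_iff:
  "rl_filter F \<longleftrightarrow> top \<in> F \<and> (\<forall>x\<in>F. \<forall>y\<in>F. x \<odot> y \<in> F) \<and> (\<forall>x\<in>F. \<forall>y\<ge>x. y \<in> F)"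
proof
  assume F: "rl_filter F"
  then obtain z where z: "z \<in> F" by (auto simp: rl_filter_def)
  have up: "y \<in> F" if "x \<in> F" "x \<le> y" for x y
  proof -
    have "sup x y \<in> F" using F that(1) by (simp add: rl_filter_def)
    then show ?thesis using that(2) by (simp add: sup.absorb2)
  qed
  have "top \<in> F" using up[OF z] by simp
  then show "top \<in> F \<and> (\<forall>x\<in>F. \<forall>y\<in>F. x \<odot> y \<in> F) \<and> (\<forall>x\<in>F. \<forall>y\<ge>x. y \<in> F)"
    using F up unfolding rl_filter_def by blast
next
  assume "top \<in> F \<and> (\<forall>x\<in>F. \<forall>y\<in>F. x \<odot> y \<in> F) \<and> (\<forall>x\<in>F. \<forall>y\<ge>x. y \<in> F)"
  then show "rl_filter F" unfolding rl_filter_def by (meson empty_iff sup_ge1)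
qed

lemma rl_filter_Inter:
  assumes "\<And>F. F \<in> \<F> \<Longrightarrow> rl_filter F" shows "rl_filter (\<Inter>\<F>)"
  using assms unfolding rl_filter_iff by auto

lemma filter_join_filter: "rl_filter (filter_join \<F>)"
  unfolding filter_join_def by (rule rl_filter_Inter) auto

lemma filter_join_subset_iff:
  assumes "rl_filter G" shows "filter_join \<F> \<subseteq> G \<longleftrightarrow> (\<forall>F\<in>\<F>. F \<subseteq> G)"
  using assms unfolding filter_join_def by auto

lemma rl_filter_residual:
  assumes P: "rl_filter P" shows "rl_filter {x. sup z x \<in> P}"
proof -
  have up: "u \<in> P \<Longrightarrow> u \<le> v \<Longrightarrow> v \<in> P" and m: "u \<in> P \<Longrightarrow> v \<in> P \<Longrightarrow> u \<odot> v \<in> P"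
    and t: "top \<in> P" for u v
    using P unfolding rl_filter_iff by blast+
  have "sup z (x \<odot> y) \<in> P" if "sup z x \<in> P" "sup z y \<in> P" for x y
    using up[OF m[OF that] rl_sup_mult] .
  moreover have "sup z y \<in> P" if "sup z x \<in> P" "x \<le> y" for x y
    using up[OF that(1) sup.mono[OF order_refl that(2)]] .
  moreover have "sup z top \<in> P" using t by simp
  ultimately show ?thesis unfolding rl_filter_iff by blast
qed

lemma exists_prime_filter:
  fixes F :: "'a::residuated_lattice set"
  assumes F: "rl_filter F" and a: "a \<notin> F"
  obtains P where "prime_filter P" "F \<subseteq> P" "a \<notin> P"
proof -
  let ?A = "{G. rl_filter G \<and> F \<subseteq> G \<and> a \<notin> G}"
  have "\<exists>M\<in>?A. \<forall>X\<in>?A. M \<subseteq> X \<longrightarrow> X = M"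
  proof (rule subset_Zorn_nonempty)
    show "?A \<noteq> {}" using F a by auto
    fix \<C> assume ne: "\<C> \<noteq> {}" and c: "subset.chain ?A \<C>"
    have sub: "\<C> \<subseteq> ?A" and lin: "\<And>X Y. X \<in> \<C> \<Longrightarrow> Y \<in> \<C> \<Longrightarrow> X \<subseteq> Y \<or> Y \<subseteq> X"
      using c by (auto simp: subset_chain_def)
    have "x \<odot> y \<in> \<Union>\<C>" if xy: "x \<in> \<Union>\<C>" "y \<in> \<Union>\<C>" for x y
    proof -
      obtain X Y where XY: "X \<in> \<C>" "x \<in> X" "Y \<in> \<C>" "y \<in> Y" using xy by auto
      then obtain Z where "Z \<in> \<C>" "x \<in> Z" "y \<in> Z" using lin by blast
      moreover from this have "rl_filter Z" using sub by auto
      ultimately show ?thesis unfolding rl_filter_def by blast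
    qed
    moreover have "top \<in> \<Union>\<C>" using ne sub by (auto simp: rl_filter_iff)
    moreover have "sup x y \<in> \<Union>\<C>" if "x \<in> \<Union>\<C>" for x y
      using that sub unfolding rl_filter_def by blast
    ultimately have "rl_filter (\<Union>\<C>)" unfolding rl_filter_def by blast
    then show "\<Union>\<C> \<in> ?A" using ne sub by auto
  qed
  then obtain P where P: "rl_filter P" "F \<subseteq> P" "a \<notin> P"
    and mx: "\<And>G. rl_filter G \<Longrightarrow> P \<subseteq> G \<Longrightarrow> a \<notin> G \<Longrightarrow> G = P"
    by (simp, metis order_trans)
  have "x \<in> P \<or> y \<in> P" if xy: "sup x y \<in> P" for x y
  proof (rule ccontr)
    assume n: "\<not> (x \<in> P \<or> y \<in> P)"
    have up: "u \<in> P \<Longrightarrow> u \<le> v \<Longrightarrow> v \<in> P" for u v using P(1) by (auto simp: rl_filter_iff)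
    let ?R = "\<lambda>z. {x. sup z x \<in> P}"
    have R: "rl_filter (?R z)" "P \<subseteq> ?R z" for z
      using rl_filter_residual[OF P(1)] up[OF _ sup_ge2] by auto
    have "a \<in> ?R x" using mx[OF R(1)[of x] R(2)] xy n by auto
    then have ax: "sup a x \<in> P" by (simp add: sup_commute)
    have "a \<in> ?R a" using mx[OF R(1)[of a] R(2)] ax n by auto
    then show False using P(3) by simp
  qed
  then have "prime_filter P" using P unfolding prime_filter_def proper_filter_def by blast
  then show ?thesis using P that by blast
qed

lemma maximal_imp_prime:
  assumes "maximal_filter M" shows "prime_filter M"
proof -
  obtain a where "a \<notin> M" using assms by (auto simp: maximal_filter_def proper_filter_def)
  then obtain P where "prime_filter P" "M \<subseteq> P"
    using exists_prime_filter assms unfolding maximal_filter_def proper_filter_def by metis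
  then show ?thesis using assms unfolding maximal_filter_def prime_filter_def by metis
qed

lemma sigma_mono: "F \<subseteq> G \<Longrightarrow> sigma F \<subseteq> sigma G"
  unfolding sigma_def by blast

lemma sigma_filter: "rl_filter (sigma F)"
  unfolding sigma_def
  by (rule rl_filter_Inter) (auto simp: prime_filter_def proper_filter_def)

lemma sigma_subset:
  assumes "rl_filter F" shows "sigma F \<subseteq> F"
proof
  fix x assume x: "x \<in> sigma F"
  show "x \<in> F"
  proof (rule ccontr)
    assume "x \<notin> F"
    then obtain P where "prime_filter P" "F \<subseteq> P" "x \<notin> P" using exists_prime_filter assms by metis
    then show False using x unfolding sigma_def by blast
  qed
qed

lemma pure_filter_UNIV: "pure_filter UNIV"
  by (auto simp: pure_filter_def rl_filter_def sigma_def prime_filter_def proper_filter_def)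

lemma pure_filter_Int:
  assumes "pure_filter F" "pure_filter G" shows "pure_filter (F \<inter> G)"
proof -
  have f: "rl_filter F" "rl_filter G" "sigma F = F" "sigma G = G"
    using assms by (auto simp: pure_filter_def)
  have fi: "rl_filter (F \<inter> G)" using rl_filter_Inter[of "{F, G}"] f by auto
  have pr: "F \<subseteq> P \<or> G \<subseteq> P" if P: "prime_filter P" "F \<inter> G \<subseteq> P" for P
  proof (rule ccontr)
    assume "\<not> ?thesis"
    then obtain x y where xy: "x \<in> F" "x \<notin> P" "y \<in> G" "y \<notin> P" by blast
    have "sup x y \<in> F" "sup x y \<in> G" using xy f by (auto simp: rl_filter_iff)
    then show False using P xy unfolding prime_filter_def by blast
  qed
  have "sigma F \<inter> sigma G \<subseteq> sigma (F \<inter> G)"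
    unfolding sigma_def using pr by blast
  then show ?thesis using fi f sigma_subset[OF fi] by (auto simp: pure_filter_def)
qed

lemma pure_filter_join:
  assumes "\<And>F. F \<in> \<F> \<Longrightarrow> pure_filter F" shows "pure_filter (filter_join \<F>)"
proof -
  have "F \<subseteq> sigma (filter_join \<F>)" if "F \<in> \<F>" for F
    using assms[OF that] filter_join_subset_iff[OF filter_join_filter, of \<F> \<F>] that
      sigma_mono[of F "filter_join \<F>"] by (auto simp: pure_filter_def)
  then have "filter_join \<F> \<subseteq> sigma (filter_join \<F>)"
    by (simp add: filter_join_subset_iff sigma_filter)
  then show ?thesis using sigma_subset[OF filter_join_filter, of \<F>] filter_join_filter
    by (auto simp: pure_filter_def)
qed

lemma openin_Max_h:
  "openin Max_h U \<longleftrightarrow> (\<exists>X. U = (\<Union>x\<in>X. Max_filters - {M \<in> Max_filters. x \<in> M}))"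
proof -
  have eq: "(\<Union>x\<in>X. Max_filters - {M \<in> Max_filters. x \<in> M}) = {M \<in> Max_filters. \<not> X \<subseteq> M}"
    for X :: "'a set" by auto
  have "istopology (\<lambda>U::'a set set. \<exists>X. U = {M \<in> Max_filters. \<not> X \<subseteq> M})"
    unfolding istopology_def
  proof (intro conjI allI impI; (elim exE)?)
    fix U V :: "'a set set" and X Y
    assume "U = {M \<in> Max_filters. \<not> X \<subseteq> M}" and "V = {M \<in> Max_filters. \<not> Y \<subseteq> M}"
    moreover have "x \<in> M \<or> y \<in> M \<longleftrightarrow> sup x y \<in> M" if "M \<in> Max_filters" for M and x y :: 'a
      using maximal_imp_prime[of M] that
      unfolding Max_filters_def prime_filter_def proper_filter_def rl_filter_iff
      by (metis mem_Collect_eq sup_ge1 sup_ge2)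
    moreover from this have "\<not> {sup x y |x y. x \<in> X \<and> y \<in> Y} \<subseteq> M \<longleftrightarrow> \<not> X \<subseteq> M \<and> \<not> Y \<subseteq> M"
      if "M \<in> Max_filters" for M
      using that by blast
    ultimately have "U \<inter> V = {M \<in> Max_filters. \<not> {sup x y |x y. x \<in> X \<and> y \<in> Y} \<subseteq> M}"
      by (simp add: set_eq_iff) blast
    then show "\<exists>Z. U \<inter> V = {M \<in> Max_filters. \<not> Z \<subseteq> M}" by blast
  next
    fix \<U> :: "'a set set set"
    assume "\<forall>U\<in>\<U>. \<exists>X. U = {M \<in> Max_filters. \<not> X \<subseteq> M}"
    then obtain X where X: "\<forall>U\<in>\<U>. U = {M \<in> Max_filters. \<not> X U \<subseteq> M}"
      unfolding bchoice_iff by blast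
    have "\<Union>\<U> = (\<Union>U\<in>\<U>. {M \<in> Max_filters. \<not> X U \<subseteq> M})" using X by simp
    also have "\<dots> = {M \<in> Max_filters. \<not> (\<Union>U\<in>\<U>. X U) \<subseteq> M}" by auto
    finally have "\<Union>\<U> = {M \<in> Max_filters. \<not> (\<Union>U\<in>\<U>. X U) \<subseteq> M}" .
    then show "\<exists>Z. \<Union>\<U> = {M \<in> Max_filters. \<not> Z \<subseteq> M}" by blast
  qed
  then show ?thesis unfolding Max_h_def eq by simp
qed

lemma openin_Spp: "openin Spp U \<longleftrightarrow> (\<exists>F. pure_filter F \<and> U = d_p F)"
proof -
  have "istopology (\<lambda>U::'a set set. \<exists>F. pure_filter F \<and> U = d_p F)"
    unfolding istopology_def
  proof (intro conjI allI impI; (elim exE conjE)?)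
    fix U V :: "'a set set" and F G
    assume "pure_filter F" "U = d_p F" "pure_filter G" "V = d_p G"
    moreover from this have "U \<inter> V = d_p (F \<inter> G)"
      unfolding d_p_def Spp_filters_def purely_prime_def by blast
    ultimately show "\<exists>H. pure_filter H \<and> U \<inter> V = d_p H" using pure_filter_Int by blast
  next
    fix \<U> :: "'a set set set"
    assume "\<forall>U\<in>\<U>. \<exists>F. pure_filter F \<and> U = d_p F"
    then obtain F where F: "\<And>U. U \<in> \<U> \<Longrightarrow> pure_filter (F U) \<and> U = d_p (F U)" by metis
    have "filter_join (F ` \<U>) \<subseteq> P \<longleftrightarrow> (\<forall>U\<in>\<U>. F U \<subseteq> P)" if "P \<in> Spp_filters" for P
      using that filter_join_subset_iff[of P "F ` \<U>"]
      by (auto simp: Spp_filters_def purely_prime_def pure_filter_def)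
    then have "d_p (filter_join (F ` \<U>)) = (\<Union>U\<in>\<U>. d_p (F U))"
      unfolding d_p_def by blast
    also have "\<dots> = \<Union>\<U>" using F by blast
    finally show "\<exists>H. pure_filter H \<and> \<Union>\<U> = d_p H"
      using pure_filter_join[of "F ` \<U>"] F by blast
  qed
  then show ?thesis unfolding Spp_def by simp
qed

lemma topspace_Max_h: "topspace Max_h = (Max_filters :: 'a::residuated_lattice set set)"
proof -
  have "bot \<notin> M" if "M \<in> Max_filters" for M :: "'a set"
    using that unfolding Max_filters_def maximal_filter_def proper_filter_def rl_filter_iff by auto
  then have "Max_filters = (\<Union>x\<in>{bot::'a}. Max_filters - {M \<in> Max_filters. x \<in> M})" by auto
  then have "openin Max_h (Max_filters :: 'a set set)" unfolding openin_Max_h by blast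
  moreover have "U \<subseteq> Max_filters" if "openin Max_h U" for U :: "'a set set"
    using that unfolding openin_Max_h by auto
  ultimately show ?thesis by (metis openin_subset openin_topspace subset_antisym)
qed

lemma topspace_Spp: "topspace Spp = (Spp_filters :: 'a::residuated_lattice set set)"
proof -
  have "d_p UNIV = (Spp_filters :: 'a set set)" by (auto simp: d_p_def Spp_filters_def purely_prime_def)
  then have "openin Spp (Spp_filters :: 'a set set)"
    using pure_filter_UNIV unfolding openin_Spp by blast
  moreover have "U \<subseteq> Spp_filters" if "openin Spp U" for U :: "'a set set"
    using that unfolding openin_Spp d_p_def by auto
  ultimately show ?thesis by (metis openin_subset openin_topspace subset_antisym)
qed

end

theory Submission
  imports Defs
begin

text \<open>
  Continuity of \<open>\<rho>\<close> on the maximal filters holds in every residuated lattice, because a pure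
  filter is contained in \<open>\<rho> M\<close> iff it is contained in \<open>M\<close>. Everything else depends on how well
  pure filters separate maximal ones.

  Suppose that the algebra is Gelfand. Distinct maximal filters \<open>M\<close>, \<open>N\<close> have no prime filter
  below both of them, and by a Zorn argument this means that there are \<open>a \<notin> M\<close> and \<open>b \<notin> N\<close> with
  \<open>a \<squnion> b = 1\<close> (\<open>gelfand_separation\<close>). The decisive consequence is that \<open>\<sigma> G\<close> and \<open>G\<close> lie in the
  same maximal filters, for every filter \<open>G\<close> (\<open>gelfand_sigma_subset_maximal\<close>); purity of \<open>\<sigma> G\<close>
  follows at once. Hence \<open>\<rho>\<close> is injective, and it is open because \<open>\<sigma>\<close> of the principal filter of
  \<open>x\<close> is a pure filter that defines the same open set of maximal filters as \<open>x\<close>. For surjectivity,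
  let \<open>P\<close> be purely prime. The elements \<open>a\<close>, \<open>b\<close> above generate filters that meet trivially, so \<open>P\<close>
  cannot lie in two maximal filters. If \<open>M\<close> is the only one, the prime filters that occur in the
  definition of \<open>\<sigma> P\<close> all lie in \<open>M\<close>, so that \<open>P = \<sigma> P\<close> contains \<open>\<sigma> M\<close> and hence \<open>\<rho> M\<close>.

  Conversely, maximal filters are pairwise incomparable, so the hull-kernel topology on them
  is T1. A homeomorphism \<open>\<rho>\<close> transports this to \<open>Spp\<close>, where the specialization order is inclusion;
  thus \<open>\<rho> K \<subseteq> \<rho> M\<close> only if \<open>K = M\<close>. For a prime filter \<open>Q\<close>, surjectivity gives
  \<open>\<rho> Q = \<rho> K\<close> with \<open>K\<close> maximal, and every maximal filter above \<open>Q\<close> must then be \<open>K\<close>.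
\<close>

section \<open>Maximal and prime filters\<close>

lemma prime_filter_imp_rl_filter: "prime_filter P \<Longrightarrow> rl_filter P"
  by (simp add: prime_filter_def proper_filter_def)

lemma maximal_filter_imp_rl_filter: "maximal_filter M \<Longrightarrow> rl_filter M"
  by (simp add: maximal_filter_def proper_filter_def)

lemma top_in_filter: "rl_filter F \<Longrightarrow> top \<in> F"
  by (simp add: rl_filter_iff)

lemma filter_upward: "rl_filter F \<Longrightarrow> x \<in> F \<Longrightarrow> x \<le> y \<Longrightarrow> y \<in> F"
  by (auto simp: rl_filter_iff)

lemma proper_filter_iff_bot: "proper_filter F \<longleftrightarrow> rl_filter F \<and> bot \<notin> F"
  unfolding proper_filter_def using filter_upward[of F bot] by auto

lemma maximal_filters_subset_eq:
  assumes "maximal_filter M" "maximal_filter N" "M \<subseteq> N" shows "M = N"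
  using assms unfolding maximal_filter_def by blast

lemma prime_filter_sup: "prime_filter P \<Longrightarrow> sup x y \<in> P \<Longrightarrow> x \<in> P \<or> y \<in> P"
  by (simp add: prime_filter_def)

lemma filter_join_singleton_subset_iff:
  assumes "rl_filter G" shows "filter_join {{x}} \<subseteq> G \<longleftrightarrow> x \<in> G"
  using filter_join_subset_iff[OF assms] by simp

lemma filter_containing_disjoint_maximal:
  fixes F :: "'a::residuated_lattice set"
  assumes F: "rl_filter F" and FT: "F \<inter> T = {}"
  obtains P where "rl_filter P" "F \<subseteq> P" "P \<inter> T = {}"
    "\<And>G. rl_filter G \<Longrightarrow> P \<subseteq> G \<Longrightarrow> G \<inter> T = {} \<Longrightarrow> G = P"
proof -
  let ?A = "{G. rl_filter G \<and> F \<subseteq> G \<and> G \<inter> T = {}}"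
  have "\<exists>M\<in>?A. \<forall>X\<in>?A. M \<subseteq> X \<longrightarrow> X = M"
  proof (rule subset_Zorn_nonempty)
    show "?A \<noteq> {}" using F FT by auto
    fix \<C> assume ne: "\<C> \<noteq> {}" and c: "subset.chain ?A \<C>"
    have sub: "\<C> \<subseteq> ?A" and lin: "\<And>X Y. X \<in> \<C> \<Longrightarrow> Y \<in> \<C> \<Longrightarrow> X \<subseteq> Y \<or> Y \<subseteq> X"
      using c by (auto simp: subset_chain_def)
    have "x \<odot> y \<in> \<Union>\<C>" if xy: "x \<in> \<Union>\<C>" "y \<in> \<Union>\<C>" for x y
    proof -
      obtain X Y where "X \<in> \<C>" "x \<in> X" "Y \<in> \<C>" "y \<in> Y" using xy by auto
      then obtain Z where "Z \<in> \<C>" "x \<in> Z" "y \<in> Z" using lin by blast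
      moreover from this have "rl_filter Z" using sub by auto
      ultimately show ?thesis unfolding rl_filter_def by blast
    qed
    moreover have "top \<in> \<Union>\<C>" using ne sub by (auto simp: rl_filter_iff)
    moreover have "sup x y \<in> \<Union>\<C>" if "x \<in> \<Union>\<C>" for x y
      using that sub unfolding rl_filter_def by blast
    ultimately have "rl_filter (\<Union>\<C>)" unfolding rl_filter_def by blast
    then show "\<Union>\<C> \<in> ?A" using ne sub by auto
  qed
  then obtain P where P: "P \<in> ?A" and mx: "\<forall>X\<in>?A. P \<subseteq> X \<longrightarrow> X = P" by (rule bexE)
  show thesis
  proof (rule that)
    show "rl_filter P" "F \<subseteq> P" "P \<inter> T = {}" using P by simp_all
    show "G = P" if "rl_filter G" "P \<subseteq> G" "G \<inter> T = {}" for G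
    proof -
      have "G \<in> ?A" using that P by auto
      then show ?thesis using mx that(2) by blast
    qed
  qed
qed

lemma exists_maximal_filter:
  fixes F :: "'a::residuated_lattice set"
  assumes "proper_filter F"
  obtains M where "maximal_filter M" "F \<subseteq> M"
proof -
  have F: "rl_filter F" "F \<inter> {bot} = {}" using assms by (auto simp: proper_filter_iff_bot)
  obtain M where M: "rl_filter M" "F \<subseteq> M" "M \<inter> {bot} = {}"
    and mx: "\<And>G. rl_filter G \<Longrightarrow> M \<subseteq> G \<Longrightarrow> G \<inter> {bot} = {} \<Longrightarrow> G = M"
    by (rule filter_containing_disjoint_maximal[OF F]) blast
  have "maximal_filter M"
    unfolding maximal_filter_def proper_filter_iff_bot using M(1,3) mx by simp
  then show thesis using M(2) by (rule that)
qed

text \<open>The prime filter theorem with respect to a set closed under joins. If \<open>P\<close> is maximal among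
  the filters disjoint from \<open>T\<close>, then each residual \<open>{w. z \<squnion> w \<in> P}\<close> is a filter above \<open>P\<close>, hence
  equal to \<open>P\<close> or meeting \<open>T\<close>. A failure \<open>x \<squnion> y \<in> P\<close> of primeness makes the residual of \<open>x\<close> meet
  \<open>T\<close> in some \<open>t\<close>, then the residual of \<open>t\<close> meet \<open>T\<close> in some \<open>t'\<close>, so that \<open>t \<squnion> t'\<close> lies in both
  \<open>P\<close> and \<open>T\<close>.\<close>

lemma exists_prime_filter_disjoint:
  fixes F :: "'a::residuated_lattice set"
  assumes F: "rl_filter F" and FT: "F \<inter> T = {}" and ne: "T \<noteq> {}"
    and T: "\<And>s t. s \<in> T \<Longrightarrow> t \<in> T \<Longrightarrow> sup s t \<in> T"
  obtains P where "prime_filter P" "F \<subseteq> P" "P \<inter> T = {}"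
proof -
  obtain P where P: "rl_filter P" "F \<subseteq> P" "P \<inter> T = {}"
    and mx: "\<And>G. rl_filter G \<Longrightarrow> P \<subseteq> G \<Longrightarrow> G \<inter> T = {} \<Longrightarrow> G = P"
    by (rule filter_containing_disjoint_maximal[OF F FT]) blast
  have meets: "\<exists>t\<in>T. sup z t \<in> P" if "w \<notin> P" "sup z w \<in> P" for z w
  proof -
    have "P \<subseteq> {x. sup z x \<in> P}" using filter_upward[OF P(1)] sup_ge2 by blast
    then show ?thesis using mx[OF rl_filter_residual[OF P(1)], of z] that by blast
  qed
  have "x \<in> P \<or> y \<in> P" if xy: "sup x y \<in> P" for x y
  proof (rule ccontr)
    assume n: "\<not> (x \<in> P \<or> y \<in> P)"
    obtain t where t: "t \<in> T" "sup x t \<in> P" using meets xy n by blast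
    obtain t' where "t' \<in> T" "sup t t' \<in> P" using meets[of x t] t n by (auto simp: sup_commute)
    then show False using T t(1) P(3) by blast
  qed
  moreover have "P \<noteq> UNIV" using ne P(3) by blast
  ultimately have "prime_filter P" using P(1) unfolding prime_filter_def proper_filter_def by blast
  then show thesis using P(2,3) by (rule that)
qed

section \<open>Pure parts\<close>

lemma pure_filter_imp_rl_filter: "pure_filter F \<Longrightarrow> rl_filter F"
  by (simp add: pure_filter_def)

lemma pure_part_pure: "pure_filter (pure_part F)"
  unfolding pure_part_def by (rule pure_filter_join) simp

lemma pure_part_subset: "rl_filter F \<Longrightarrow> pure_part F \<subseteq> F"
  unfolding pure_part_def by (simp add: filter_join_subset_iff)

lemma subset_pure_part_iff:
  assumes "pure_filter G" "rl_filter F" shows "G \<subseteq> pure_part F \<longleftrightarrow> G \<subseteq> F"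
proof
  assume "G \<subseteq> F"
  then have "G \<in> {G. pure_filter G \<and> G \<subseteq> F}" using assms by simp
  then show "G \<subseteq> pure_part F"
    unfolding pure_part_def filter_join_def by blast
qed (use pure_part_subset[OF assms(2)] in blast)

lemma pure_part_mono:
  assumes "rl_filter F" "rl_filter G" "F \<subseteq> G" shows "pure_part F \<subseteq> pure_part G"
  using subset_pure_part_iff[OF pure_part_pure[of F] assms(2)] pure_part_subset[OF assms(1)] assms(3)
  by simp

text \<open>A prime filter is prime with respect to intersections of arbitrary filters, and pure
  filters do not distinguish \<open>P\<close> from its pure part.\<close>

lemma pure_part_prime_in_Spp:
  assumes P: "prime_filter P" shows "pure_part P \<in> Spp_filters"
proof -
  have fP: "rl_filter P" using P by (rule prime_filter_imp_rl_filter)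
  have "F \<subseteq> P \<or> G \<subseteq> P" if "pure_filter F" "pure_filter G" "F \<inter> G \<subseteq> P" for F G
  proof (rule ccontr)
    assume "\<not> ?thesis"
    then obtain x y where xy: "x \<in> F" "x \<notin> P" "y \<in> G" "y \<notin> P" by blast
    have "sup x y \<in> F \<inter> G"
      using filter_upward[OF pure_filter_imp_rl_filter[OF that(1)] xy(1) sup_ge1]
        filter_upward[OF pure_filter_imp_rl_filter[OF that(2)] xy(3) sup_ge2] by simp
    then show False using prime_filter_sup[OF P] xy that(3) by blast
  qed
  then have "F \<subseteq> pure_part P \<or> G \<subseteq> pure_part P"
    if "pure_filter F" "pure_filter G" "F \<inter> G \<subseteq> pure_part P" for F G
    using that pure_part_subset[OF fP] subset_pure_part_iff[OF _ fP] by (meson order_trans)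
  moreover have "pure_part P \<noteq> UNIV"
    using pure_part_subset[OF fP] P by (auto simp: prime_filter_def proper_filter_def)
  ultimately show ?thesis
    unfolding Spp_filters_def purely_prime_def using pure_part_pure[of P] by simp
qed

lemma pure_part_maximal_in_Spp: "M \<in> Max_filters \<Longrightarrow> pure_part M \<in> Spp_filters"
  by (simp add: Max_filters_def maximal_imp_prime pure_part_prime_in_Spp)

lemma openin_Max_h_not_subset: "openin Max_h {M \<in> Max_filters. \<not> X \<subseteq> M}"
proof -
  have "{M \<in> Max_filters. \<not> X \<subseteq> M} = (\<Union>x\<in>X. Max_filters - {M \<in> Max_filters. x \<in> M})" by auto
  then show ?thesis unfolding openin_Max_h by blast
qed

lemma continuous_map_pure_part:
  "continuous_map Max_h Spp (pure_part :: 'a::residuated_lattice set \<Rightarrow> 'a set)"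
  unfolding continuous_map topspace_Max_h topspace_Spp
proof (intro conjI allI impI)
  show "pure_part ` Max_filters \<subseteq> (Spp_filters :: 'a set set)"
    using pure_part_maximal_in_Spp by blast
  fix U :: "'a set set" assume "openin Spp U"
  then obtain F where F: "pure_filter F" "U = d_p F" unfolding openin_Spp by blast
  have "{M \<in> Max_filters. pure_part M \<in> U} = {M \<in> Max_filters. \<not> F \<subseteq> M}"
    unfolding F(2) d_p_def
    using pure_part_maximal_in_Spp subset_pure_part_iff[OF F(1) maximal_filter_imp_rl_filter]
    by (auto simp: Max_filters_def)
  then show "openin Max_h {M \<in> Max_filters. pure_part M \<in> U}"
    using openin_Max_h_not_subset by simp
qed

section \<open>Gelfand residuated lattices\<close>

lemma gelfand_maximal_unique:
  assumes "gelfand TYPE('a::residuated_lattice)" "prime_filter (P :: 'a set)"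
    and "maximal_filter M" "P \<subseteq> M" "maximal_filter N" "P \<subseteq> N"
  shows "M = N"
  using assms unfolding gelfand_def by blast

text \<open>The joins \<open>a \<squnion> b\<close> with \<open>a \<notin> M\<close> and \<open>b \<notin> N\<close> form a set closed under joins that contains the
  complements of \<open>M\<close> and \<open>N\<close>. If \<open>1\<close> were not in it, some prime filter would be disjoint from it
  and thus lie below both \<open>M\<close> and \<open>N\<close>.\<close>

lemma gelfand_separation:
  fixes M N :: "'a::residuated_lattice set"
  assumes g: "gelfand TYPE('a)" and M: "maximal_filter M" and N: "maximal_filter N" and "M \<noteq> N"
  obtains a b where "a \<notin> M" "b \<notin> N" "sup a b = top"
proof (rule ccontr)
  assume "\<not> thesis"
  then have no: "a \<notin> M \<Longrightarrow> b \<notin> N \<Longrightarrow> sup a b \<noteq> top" for a b using that by metis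
  let ?T = "{sup a b |a b. a \<notin> M \<and> b \<notin> N}"
  have bot: "bot \<notin> M" "bot \<notin> N"
    using M N by (auto simp: maximal_filter_def proper_filter_iff_bot)
  have filt: "rl_filter {top::'a}"
    using rl_mult_top[of "top::'a"] by (auto simp: rl_filter_iff top_unique)
  have disj: "{top} \<inter> ?T = {}" using no by fastforce
  have ne: "?T \<noteq> {}" using bot by blast
  have clo: "sup s t \<in> ?T" if st: "s \<in> ?T" "t \<in> ?T" for s t
  proof -
    obtain a b a' b' where s: "s = sup a b" "a \<notin> M" "b \<notin> N" and t: "t = sup a' b'" "a' \<notin> M" "b' \<notin> N"
      using st by blast
    have "sup a a' \<notin> M" "sup b b' \<notin> N"
      using s t prime_filter_sup[OF maximal_imp_prime[OF M], of a a']
        prime_filter_sup[OF maximal_imp_prime[OF N], of b b'] by auto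
    moreover have "sup s t = sup (sup a a') (sup b b')" by (simp add: s t ac_simps)
    ultimately show ?thesis by blast
  qed
  obtain P where P: "prime_filter P" "P \<inter> ?T = {}"
    by (rule exists_prime_filter_disjoint[OF filt disj ne clo])
  have inT: "x \<in> ?T" if "x \<notin> M \<or> x \<notin> N" for x
  proof -
    have "x = sup x bot" "x = sup bot x" by simp_all
    then show ?thesis using that bot by blast
  qed
  then have "P \<subseteq> M" "P \<subseteq> N" using P(2) by blast+
  then show False using gelfand_maximal_unique[OF g P(1)] M N \<open>M \<noteq> N\<close> by blast
qed

lemma rl_mult_left_commute:
  fixes x y z :: "'a::residuated_lattice"
  shows "x \<odot> (y \<odot> z) = y \<odot> (x \<odot> z)"
  using rl_mult_assoc[of x y z] rl_mult_assoc[of y x z] rl_mult_commute[of x y] by simp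

lemma rl_filter_products:
  fixes F G :: "'a::residuated_lattice set"
  assumes F: "rl_filter F" and G: "rl_filter G"
  shows "rl_filter {z. \<exists>x\<in>F. \<exists>y\<in>G. x \<odot> y \<le> z}"
  unfolding rl_filter_iff
proof (intro conjI ballI allI impI)
  show "top \<in> {z. \<exists>x\<in>F. \<exists>y\<in>G. x \<odot> y \<le> z}" using top_in_filter[OF F] top_in_filter[OF G] by auto
  fix z z' assume "z \<in> {z. \<exists>x\<in>F. \<exists>y\<in>G. x \<odot> y \<le> z}" "z' \<in> {z. \<exists>x\<in>F. \<exists>y\<in>G. x \<odot> y \<le> z}"
  then obtain x y x' y' where *: "x \<in> F" "y \<in> G" "x \<odot> y \<le> z" "x' \<in> F" "y' \<in> G" "x' \<odot> y' \<le> z'"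
    by blast
  have "(x \<odot> x') \<odot> (y \<odot> y') = (x \<odot> y) \<odot> (x' \<odot> y')"
    by (simp add: rl_mult_assoc rl_mult_left_commute)
  then have "(x \<odot> x') \<odot> (y \<odot> y') \<le> z \<odot> z'" using rl_mult_mono[OF *(3,6)] by simp
  moreover have "x \<odot> x' \<in> F" "y \<odot> y' \<in> G" using F G * by (auto simp: rl_filter_def)
  ultimately show "z \<odot> z' \<in> {z. \<exists>x\<in>F. \<exists>y\<in>G. x \<odot> y \<le> z}" by blast
qed (auto intro: order_trans)

text \<open>This is the union of the filters \<open>a\<^sup>\<bottom>\<close> with \<open>a \<notin> P\<close>. The union is directed, and hence a filter,
  because the complement of a prime filter is closed under joins.\<close>

lemma rl_filter_prime_complement_polars:
  fixes P :: "'a::residuated_lattice set"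
  assumes P: "prime_filter P"
  shows "rl_filter {b. \<exists>a. a \<notin> P \<and> sup a b = top}"
  unfolding rl_filter_iff
proof (intro conjI ballI allI impI)
  show "top \<in> {b. \<exists>a. a \<notin> P \<and> sup a b = top}"
    using P by (auto simp: prime_filter_def proper_filter_def)
  fix b assume "b \<in> {b. \<exists>a. a \<notin> P \<and> sup a b = top}"
  then obtain a where a: "a \<notin> P" "sup a b = top" by blast
  show "c \<in> {b. \<exists>a. a \<notin> P \<and> sup a b = top}" if "b \<le> c" for c
  proof -
    have "sup a b \<le> sup a c" using that by (simp add: le_supI2)
    then have "sup a c = top" using a by (simp add: top_unique)
    then show ?thesis using a by blast
  qed
  show "b \<odot> b' \<in> {b. \<exists>a. a \<notin> P \<and> sup a b = top}"
    if b': "b' \<in> {b. \<exists>a. a \<notin> P \<and> sup a b = top}" for b'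
  proof -
    obtain a' where a': "a' \<notin> P" "sup a' b' = top" using b' by blast
    let ?c = "sup a a'"
    have "sup ?c b = top" "sup ?c b' = top"
      using a(2) a'(2) by (simp_all add: sup.assoc sup.left_commute[of a a'])
    then have "sup ?c (b \<odot> b') = top"
      using rl_sup_mult[of ?c b b'] rl_mult_top[of "top::'a"] by (simp add: top_unique)
    moreover have "?c \<notin> P" using prime_filter_sup[OF P] a a' by blast
    ultimately show ?thesis by blast
  qed
qed

text \<open>Suppose that \<open>G\<close> is not contained in \<open>M\<close>, and let \<open>K\<close> be the filter of all \<open>b\<close> with
  \<open>a \<squnion> b = 1\<close> for some \<open>a \<notin> M\<close>. A maximal filter above \<open>G\<close> and \<open>K\<close> would differ from \<open>M\<close>, and
  separating it from \<open>M\<close> would produce an element of \<open>K\<close> outside it. So \<open>G\<close> and \<open>K\<close> generate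
  everything, and \<open>g \<odot> k = 0\<close> for some \<open>g \<in> G\<close> and \<open>k \<in> K\<close>. The \<open>a \<notin> M\<close> with \<open>a \<squnion> k = 1\<close> then lies
  in \<open>\<sigma> G\<close>, since no proper filter above \<open>G\<close> contains \<open>k\<close>.\<close>

lemma gelfand_sigma_subset_maximal:
  fixes M G :: "'a::residuated_lattice set"
  assumes g: "gelfand TYPE('a)" and G: "rl_filter G" and M: "maximal_filter M"
    and sG: "sigma G \<subseteq> M"
  shows "G \<subseteq> M"
proof (rule ccontr)
  assume nG: "\<not> G \<subseteq> M"
  let ?K = "{b. \<exists>a. a \<notin> M \<and> sup a b = top}"
  let ?J = "{z. \<exists>x\<in>G. \<exists>y\<in>?K. x \<odot> y \<le> z}"
  have K: "rl_filter ?K" by (rule rl_filter_prime_complement_polars[OF maximal_imp_prime[OF M]])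
  have "bot \<in> ?J"
  proof (rule ccontr)
    assume "bot \<notin> ?J"
    then have "proper_filter ?J" using rl_filter_products[OF G K] proper_filter_iff_bot by blast
    then obtain N where N: "maximal_filter N" "?J \<subseteq> N" using exists_maximal_filter by blast
    have "G \<subseteq> ?J" using rl_mult_le(1) top_in_filter[OF K] by blast
    then have "M \<noteq> N" using nG N(2) by blast
    then obtain a b where "a \<notin> M" "b \<notin> N" "sup a b = top"
      using gelfand_separation[OF g M N(1)] by blast
    moreover have "?K \<subseteq> ?J" using rl_mult_le(2) top_in_filter[OF G] by blast
    ultimately show False using N(2) by blast
  qed
  then obtain x k a where x: "x \<in> G" "x \<odot> k \<le> bot" and a: "a \<notin> M" "sup a k = top" by blast
  have "a \<in> Q" if Q: "prime_filter Q" and P: "prime_filter P" "G \<subseteq> P" "Q \<subseteq> P" for P Q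
  proof (rule ccontr)
    assume "a \<notin> Q"
    then have "k \<in> P"
      using prime_filter_sup[OF Q, of a k] a(2) top_in_filter[OF prime_filter_imp_rl_filter[OF Q]] P(3)
      by auto
    then have "x \<odot> k \<in> P"
      using x(1) P(2) prime_filter_imp_rl_filter[OF P(1)] by (auto simp: rl_filter_def)
    then have "bot \<in> P" using filter_upward[OF prime_filter_imp_rl_filter[OF P(1)] _ x(2)] by simp
    then show False using P(1) by (simp add: prime_filter_def proper_filter_iff_bot)
  qed
  then have "a \<in> sigma G" unfolding sigma_def by blast
  then show False using sG a(1) by blast
qed

text \<open>Each prime filter above \<open>\<sigma> G\<close> extends to a maximal filter, which contains \<open>G\<close>; so no
  prime filter enters \<open>\<sigma> (\<sigma> G)\<close> that does not already enter \<open>\<sigma> G\<close>.\<close>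

lemma gelfand_sigma_pure:
  fixes G :: "'a::residuated_lattice set"
  assumes g: "gelfand TYPE('a)" and G: "rl_filter G"
  shows "pure_filter (sigma G)"
proof -
  have "sigma G \<subseteq> Q"
    if Q: "prime_filter Q" and P: "prime_filter P" "sigma G \<subseteq> P" "Q \<subseteq> P" for P Q
  proof -
    obtain M where M: "maximal_filter M" "P \<subseteq> M"
      using exists_maximal_filter P(1) unfolding prime_filter_def by blast
    then have "G \<subseteq> M" using gelfand_sigma_subset_maximal[OF g G] P(2) by blast
    then show ?thesis
      unfolding sigma_def using Q maximal_imp_prime[OF M(1)] P(3) M(2) by blast
  qed
  then have "sigma G \<subseteq> sigma (sigma G)" unfolding sigma_def[of "sigma G"] by blast
  then show ?thesis
    using sigma_subset[OF sigma_filter, of G] sigma_filter[of G] by (auto simp: pure_filter_def)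
qed

lemma gelfand_inj_on_pure_part:
  assumes g: "gelfand TYPE('a::residuated_lattice)"
  shows "inj_on pure_part (Max_filters :: 'a set set)"
proof (rule inj_onI)
  fix M N :: "'a set"
  assume "M \<in> Max_filters" "N \<in> Max_filters" and eq: "pure_part M = pure_part N"
  then have M: "maximal_filter M" and N: "maximal_filter N" by (auto simp: Max_filters_def)
  note fM = maximal_filter_imp_rl_filter[OF M] and fN = maximal_filter_imp_rl_filter[OF N]
  have "sigma M \<subseteq> pure_part N"
    using subset_pure_part_iff[OF gelfand_sigma_pure[OF g fM] fM] sigma_subset[OF fM] eq by simp
  then have "sigma M \<subseteq> N" using pure_part_subset[OF fN] by blast
  then have "M \<subseteq> N" by (rule gelfand_sigma_subset_maximal[OF g fM N])
  then show "M = N" by (rule maximal_filters_subset_eq[OF M N])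
qed

text \<open>If \<open>a \<squnion> b = 1\<close>, then every prime filter contains \<open>a\<close> or \<open>b\<close>, so the filters generated by
  \<open>a\<close> and by \<open>b\<close> meet only in \<open>1\<close>. Their images under \<open>\<sigma>\<close> are pure, and a purely prime filter must
  contain one of them.\<close>

lemma gelfand_purely_prime_maximal_unique:
  fixes P M N :: "'a::residuated_lattice set"
  assumes g: "gelfand TYPE('a)" and P: "purely_prime P"
    and M: "maximal_filter M" "P \<subseteq> M" and N: "maximal_filter N" "P \<subseteq> N"
  shows "M = N"
proof (rule ccontr)
  assume "M \<noteq> N"
  then obtain a b where ab: "a \<notin> M" "b \<notin> N" "sup a b = top"
    using gelfand_separation[OF g M(1) N(1)] by blast
  let ?A = "filter_join {{a}}" and ?B = "filter_join {{b}}"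
  have fP: "rl_filter P" using P by (simp add: purely_prime_def pure_filter_def)
  have "sigma ?A \<inter> sigma ?B \<subseteq> Q" if Q: "prime_filter Q" for Q
  proof -
    note fQ = prime_filter_imp_rl_filter[OF Q]
    have "a \<in> Q \<or> b \<in> Q" using prime_filter_sup[OF Q, of a b] ab(3) top_in_filter[OF fQ] by simp
    then have "?A \<subseteq> Q \<or> ?B \<subseteq> Q" using filter_join_singleton_subset_iff[OF fQ] by simp
    then show ?thesis
      using sigma_subset[OF filter_join_filter, of "{{a}}"]
        sigma_subset[OF filter_join_filter, of "{{b}}"] by blast
  qed
  then have "sigma ?A \<inter> sigma ?B \<subseteq> P" using exists_prime_filter[OF fP] by blast
  then have "sigma ?A \<subseteq> P \<or> sigma ?B \<subseteq> P"
    using P gelfand_sigma_pure[OF g filter_join_filter] unfolding purely_prime_def by blast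
  then have "?A \<subseteq> M \<or> ?B \<subseteq> N"
    using gelfand_sigma_subset_maximal[OF g filter_join_filter] M N by blast
  then show False
    using ab filter_join_singleton_subset_iff maximal_filter_imp_rl_filter M(1) N(1) by blast
qed

lemma gelfand_purely_prime_eq_pure_part:
  fixes P :: "'a::residuated_lattice set"
  assumes g: "gelfand TYPE('a)" and P: "purely_prime P"
  obtains M where "maximal_filter M" "P = pure_part M"
proof -
  have pP: "pure_filter P" "P \<noteq> UNIV" using P by (auto simp: purely_prime_def)
  obtain M where M: "maximal_filter M" "P \<subseteq> M"
    using exists_maximal_filter[of P] pP by (auto simp: proper_filter_def pure_filter_def)
  have fM: "rl_filter M" by (rule maximal_filter_imp_rl_filter[OF M(1)])
  have "Q \<subseteq> M" if "prime_filter R" "P \<subseteq> R" "Q \<subseteq> R" for Q R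
  proof -
    obtain N where "maximal_filter N" "R \<subseteq> N"
      using exists_maximal_filter \<open>prime_filter R\<close> unfolding prime_filter_def by blast
    then show ?thesis using gelfand_purely_prime_maximal_unique[OF g P M] that by blast
  qed
  then have "sigma M \<subseteq> sigma P" unfolding sigma_def using maximal_imp_prime[OF M(1)] by blast
  moreover have "pure_part M \<subseteq> sigma M"
    using pure_part_pure[of M] sigma_mono[OF pure_part_subset[OF fM]] by (simp add: pure_filter_def)
  moreover have "P \<subseteq> pure_part M" using subset_pure_part_iff[OF pP(1) fM] M(2) by simp
  ultimately have "P = pure_part M" using pP(1) by (auto simp: pure_filter_def)
  with M(1) show thesis by (rule that)
qed

lemma gelfand_pure_part_surj:
  assumes g: "gelfand TYPE('a::residuated_lattice)"
  shows "pure_part ` Max_filters = (Spp_filters :: 'a set set)"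
proof
  show "pure_part ` Max_filters \<subseteq> (Spp_filters :: 'a set set)"
    using pure_part_maximal_in_Spp by blast
  show "(Spp_filters :: 'a set set) \<subseteq> pure_part ` Max_filters"
  proof
    fix P :: "'a set" assume "P \<in> Spp_filters"
    then obtain M where "maximal_filter M" "P = pure_part M"
      using gelfand_purely_prime_eq_pure_part[OF g] unfolding Spp_filters_def by blast
    then show "P \<in> pure_part ` Max_filters" by (simp add: Max_filters_def)
  qed
qed

text \<open>An open set of maximal filters has the form \<open>{M. \<not> X \<subseteq> M}\<close>. With \<open>G\<close> the filter
  generated by \<open>X\<close>, it is defined equally well by the pure filter \<open>\<sigma> G\<close>, and pure filters do not
  distinguish \<open>M\<close> from \<open>\<rho> M\<close>.\<close>

lemma gelfand_open_map_pure_part: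
  assumes g: "gelfand TYPE('a::residuated_lattice)"
  shows "open_map Max_h Spp (pure_part :: 'a set \<Rightarrow> 'a set)"
  unfolding open_map_def
proof (intro allI impI)
  fix U :: "'a set set" assume "openin Max_h U"
  then obtain X where "U = (\<Union>x\<in>X. Max_filters - {M \<in> Max_filters. x \<in> M})"
    unfolding openin_Max_h by blast
  then have U: "U = {M \<in> Max_filters. \<not> X \<subseteq> M}" by auto
  let ?S = "sigma (filter_join {X})"
  have pS: "pure_filter ?S" by (rule gelfand_sigma_pure[OF g filter_join_filter])
  have S: "?S \<subseteq> pure_part M \<longleftrightarrow> X \<subseteq> M" if "M \<in> Max_filters" for M
  proof -
    have M: "maximal_filter M" "rl_filter M"
      using that maximal_filter_imp_rl_filter by (auto simp: Max_filters_def)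
    have "?S \<subseteq> M \<longleftrightarrow> filter_join {X} \<subseteq> M"
      using gelfand_sigma_subset_maximal[OF g filter_join_filter M(1), of "{X}"]
        sigma_subset[OF filter_join_filter, of "{X}"] by blast
    also have "\<dots> \<longleftrightarrow> X \<subseteq> M" using filter_join_subset_iff[OF M(2)] by simp
    finally show ?thesis using subset_pure_part_iff[OF pS M(2)] by simp
  qed
  have "d_p ?S = {P \<in> pure_part ` Max_filters. \<not> ?S \<subseteq> P}"
    unfolding d_p_def gelfand_pure_part_surj[OF g] by (rule refl)
  also have "\<dots> = pure_part ` U" unfolding U using S by blast
  finally show "openin Spp (pure_part ` U)" unfolding openin_Spp using pS by blast
qed

section \<open>The homeomorphism\<close>

text \<open>If some \<open>x \<in> K\<close> were outside \<open>M\<close>, the open set of the maximal filters that avoid \<open>x\<close> would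
  contain \<open>M\<close> but not \<open>K\<close>. Its image is open in \<open>Spp\<close> and contains \<open>\<rho> M\<close>; open sets of \<open>Spp\<close> are
  closed under passing to smaller filters, so \<open>\<rho> K\<close> would be in the image too.\<close>

lemma homeomorphic_pure_part_reflects_subset:
  fixes K M :: "'a::residuated_lattice set"
  assumes h: "homeomorphic_map Max_h Spp (pure_part :: 'a set \<Rightarrow> 'a set)"
    and K: "K \<in> Max_filters" and M: "M \<in> Max_filters" and sub: "pure_part K \<subseteq> pure_part M"
  shows "K \<subseteq> M"
proof
  fix x assume x: "x \<in> K"
  have inj: "inj_on pure_part (Max_filters :: 'a set set)"
    using homeomorphic_imp_injective_map[OF h] by (simp add: topspace_Max_h)
  show "x \<in> M"
  proof (rule ccontr)
    assume "x \<notin> M"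
    let ?U = "{N \<in> Max_filters. \<not> {x} \<subseteq> N}"
    have "openin Spp (pure_part ` ?U)"
      using homeomorphic_imp_open_map[OF h] openin_Max_h_not_subset unfolding open_map_def by blast
    then obtain F where F: "pure_part ` ?U = d_p F" unfolding openin_Spp by blast
    have "pure_part M \<in> d_p F" using F M \<open>x \<notin> M\<close> by blast
    then have "pure_part K \<in> d_p F"
      using pure_part_maximal_in_Spp[OF K] sub by (auto simp: d_p_def)
    then obtain N where "N \<in> ?U" "pure_part K = pure_part N" using F by blast
    then show False using inj_onD[OF inj, of K N] K x by blast
  qed
qed

lemma homeomorphic_pure_part_imp_gelfand:
  assumes h: "homeomorphic_map Max_h Spp (pure_part :: 'a::residuated_lattice set \<Rightarrow> 'a set)"
  shows "gelfand TYPE('a)"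
  unfolding gelfand_def
proof (intro allI impI)
  fix Q :: "'a set" assume Q: "prime_filter Q"
  have "pure_part Q \<in> pure_part ` Max_filters"
    using pure_part_prime_in_Spp[OF Q] homeomorphic_imp_surjective_map[OF h]
    by (simp add: topspace_Max_h topspace_Spp)
  then obtain K where K: "K \<in> Max_filters" "pure_part Q = pure_part K" by blast
  have eq: "M = K" if M: "maximal_filter M" "Q \<subseteq> M" for M
  proof -
    have "pure_part K \<subseteq> pure_part M"
      using pure_part_mono[OF prime_filter_imp_rl_filter[OF Q] maximal_filter_imp_rl_filter[OF M(1)] M(2)]
        K(2) by simp
    then have "K \<subseteq> M"
      using homeomorphic_pure_part_reflects_subset[OF h K(1)] M(1) by (simp add: Max_filters_def)
    then show ?thesis
      using maximal_filters_subset_eq[of K M] K(1) M(1) by (simp add: Max_filters_def)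
  qed
  obtain M where "maximal_filter M" "Q \<subseteq> M"
    using exists_maximal_filter Q unfolding prime_filter_def by blast
  then show "\<exists>!M. maximal_filter M \<and> Q \<subseteq> M" using eq by blast
qed

theorem theorem4p13:
  "gelfand TYPE('a::residuated_lattice) \<longleftrightarrow>
   homeomorphic_map (Max_h :: 'a set topology) (Spp :: 'a set topology) pure_part"
proof
  assume g: "gelfand TYPE('a)"
  show "homeomorphic_map (Max_h :: 'a set topology) (Spp :: 'a set topology) pure_part"
    using bijective_open_imp_homeomorphic_map[OF continuous_map_pure_part
        gelfand_open_map_pure_part[OF g]] gelfand_pure_part_surj[OF g] gelfand_inj_on_pure_part[OF g]
    by (simp add: topspace_Max_h topspace_Spp)
qed (rule homeomorphic_pure_part_imp_gelfand)

end
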